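(* Let $q$ be a prime power and let $m,k$ be integers with $2\le k\le\left\lfloor\frac{m+1}{2}\right\rfloor$. For every $n\in\{m,\ldots,2m-2k+1\}$ there exists a nondegenerate rank-metric intersecting $[n,k,d]_{q^m/q}$ code with $d>\frac{n}{2}$.
   Context: Support and rank: fix an $\mathbb{F}_q$-basis $\Gamma$ of $\mathbb{F}_{q^m}$. For $x=(x_1,\dots,x_n)\in\mathbb{F}_{q^m}^n$ let $\mathrm{Mat}_\Gamma(x)\in\mathbb{F}_q^{m\times n}$ be the matrix whose $j$-th column is the coordinate vector of $x_j$ in the basis $\Gamma$. The support $\sigma(x)\subseteq\mathbb{F}_q^n$ is the $\mathbb{F}_q$-row space of $\mathrm{Mat}_\Gamma(x)$, and $\mathrm{rk}(x)=\dim_{\mathbb{F}_q}\sigma(x)$; both are independent of $\Gamma$. An $[n,k,d]_{q^m/q}$ code is an $\mathbb{F}_{q^m}$-linear subspace $\mathcal{C}$ of $\mathbb{F}_{q^m}^n$ with $k=\dim_{\mathbb{F}_{q^m}}\mathcal{C}\ge 1$ and minimum distance $d=\min_{c\in\mathcal{C}\setminus\{0\}}\mathrm{rk}(c)$. The code is nondegenerate if $\sum_{c\in\mathcal{C}}\sigma(c)=\mathbb{F}_q^n$. It is rank-metric intersecting if $\sigma(c)\cap\sigma(c')\ne\{0\}$ for all $c,c'\in\mathcal{C}\setminus\{0\}$. *)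

theory Defs
  imports
    "Jordan_Normal_Form.VS_Connect"
    "HOL-Number_Theory.Prime_Powers"
    "HOL-Library.Cardinality"
begin

text \<open>The extension of finite fields is given by a field embedding \<open>\<iota>\<close> of the small field
  \<open>'a\<close> into the large field \<open>'b\<close>; the large field is a vector space over the small one via
  \<open>a \<cdot> y = \<iota> a * y\<close>.\<close>

definition ext_scale :: "('a \<Rightarrow> 'b) \<Rightarrow> 'a \<Rightarrow> 'b \<Rightarrow> ('b :: field)" where
  "ext_scale \<iota> a y = \<iota> a * y"

lemma vector_space_ext_scale:
  assumes "field_hom \<iota>"
  shows "vector_space (ext_scale \<iota>)"
proof -
  interpret field_hom \<iota> by fact
  show ?thesis
    by unfold_locales (simp_all add: ext_scale_def hom_distribs algebra_simps)
qed

text \<open>A basis is an ordered one, given as a list; its order fixes the order of the rows of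
  \<open>coord_mat\<close>.\<close>

definition ext_basis :: "('a :: field \<Rightarrow> 'b :: field) \<Rightarrow> 'b list \<Rightarrow> bool" where
  "ext_basis \<iota> \<Gamma> \<longleftrightarrow> distinct \<Gamma> \<and>
     \<not> Modules.module.dependent (ext_scale \<iota>) (set \<Gamma>) \<and>
     Modules.module.span (ext_scale \<iota>) (set \<Gamma>) = UNIV"

definition coord_mat :: "('a :: field \<Rightarrow> 'b :: field) \<Rightarrow> 'b list \<Rightarrow> 'b vec \<Rightarrow> 'a mat" where
  "coord_mat \<iota> \<Gamma> x = mat (length \<Gamma>) (dim_vec x)
     (\<lambda>(i, j). Modules.module.representation (ext_scale \<iota>) (set \<Gamma>) (x $ j) (\<Gamma> ! i))"

definition rank_support :: "('a :: field \<Rightarrow> 'b :: field) \<Rightarrow> 'b list \<Rightarrow> 'b vec \<Rightarrow> 'a vec set" where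
  "rank_support \<iota> \<Gamma> x = vec_space.row_space (dim_vec x) (coord_mat \<iota> \<Gamma> x)"

definition subspace_dim :: "nat \<Rightarrow> 'c :: field vec set \<Rightarrow> nat" where
  "subspace_dim n W = vectorspace.dim class_ring (module_vec TYPE('c) n\<lparr>carrier := W\<rparr>)"

definition rank_weight :: "('a :: field \<Rightarrow> 'b :: field) \<Rightarrow> 'b list \<Rightarrow> 'b vec \<Rightarrow> nat" where
  "rank_weight \<iota> \<Gamma> x = subspace_dim (dim_vec x) (rank_support \<iota> \<Gamma> x)"

text \<open>For \<open>k \<ge> 1\<close> the set of weights is nonempty, and it is bounded by \<open>n\<close>, so \<open>Min\<close> is the
  true minimum.\<close>

definition rank_metric_code ::
  "('a :: field \<Rightarrow> 'b :: field) \<Rightarrow> 'b list \<Rightarrow> nat \<Rightarrow> nat \<Rightarrow> nat \<Rightarrow> 'b vec set \<Rightarrow> bool" where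
  "rank_metric_code \<iota> \<Gamma> n k d C \<longleftrightarrow>
     VectorSpace.subspace class_ring C (module_vec TYPE('b) n) \<and>
     subspace_dim n C = k \<and> k \<ge> 1 \<and>
     d = Min (rank_weight \<iota> \<Gamma> ` (C - {0\<^sub>v n}))"

text \<open>The sum of the supports over all codewords, as the set of all sums of one vector from
  each support. Codes over a finite field are finite, so \<open>finsum_vec\<close> is not degenerate here.\<close>

definition nondegenerate_code ::
  "('a :: field \<Rightarrow> 'b :: {field, finite}) \<Rightarrow> 'b list \<Rightarrow> nat \<Rightarrow> 'b vec set \<Rightarrow> bool" where
  "nondegenerate_code \<iota> \<Gamma> n C \<longleftrightarrow>
     {finsum_vec TYPE('a) n v C | v. \<forall>c\<in>C. v c \<in> rank_support \<iota> \<Gamma> c} = carrier_vec n"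

definition rank_metric_intersecting ::
  "('a :: field \<Rightarrow> 'b :: field) \<Rightarrow> 'b list \<Rightarrow> nat \<Rightarrow> 'b vec set \<Rightarrow> bool" where
  "rank_metric_intersecting \<iota> \<Gamma> n C \<longleftrightarrow>
     (\<forall>c\<in>C - {0\<^sub>v n}. \<forall>c'\<in>C - {0\<^sub>v n}.
        rank_support \<iota> \<Gamma> c \<inter> rank_support \<iota> \<Gamma> c' \<noteq> {0\<^sub>v n})"

end

theory Submission
  imports Defs "HOL-Number_Theory.Residues"
begin

text \<open>
  If all nonzero codewords have rank greater than \<open>n / 2\<close>, then any two supports meet for dimension
  reasons, so only a nondegenerate code with \<open>2 d > n\<close> is needed. The Gabidulin code, which evaluates
  the linearized polynomials \<open>f\<^sub>0 y + f\<^sub>1 y^q + \<dots> + f\<^bsub>k-1\<^esub> y^(q^(k-1))\<close> at a basis \<open>\<Gamma>\<close>, has length \<open>m\<close> and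
  distance \<open>m - k + 1\<close>, because such a polynomial has at most \<open>q^(k-1)\<close> roots. Appending coordinates
  cannot decrease the rank, and \<open>n < 2 (m - k + 1)\<close>. The appended coordinates \<open>f\<^sub>0 \<Gamma>\<^sub>0, f\<^sub>0 \<Gamma>\<^sub>1, \<dots>\<close> keep the
  columns of the generator matrix independent over the small field: the columns \<open>(\<Gamma>\<^sub>j, \<Gamma>\<^sub>j^q, \<dots>)\<close> are
  already independent in their second entry, which exists since \<open>k \<ge> 2\<close>, and the new columns
  \<open>(\<Gamma>\<^sub>l, 0, \<dots>)\<close> vanish there.

  All facts on dimensions and duality are obtained by counting, using \<open>card W = q^dim W\<close>.
\<close>

subsection \<open>Counting in subspaces of finite coordinate spaces\<close>

lemma bij_betw_vec: "bij_betw (vec n) ({..<n} \<rightarrow>\<^sub>E UNIV) (carrier_vec n)"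
proof (rule bij_betwI)
  show "vec n \<in> ({..<n} \<rightarrow>\<^sub>E UNIV) \<rightarrow> carrier_vec n" by (rule funcsetI) (rule vec_carrier)
  show "(\<lambda>v. restrict (($) v) {..<n}) \<in> carrier_vec n \<rightarrow> {..<n} \<rightarrow>\<^sub>E UNIV" by simp
  show "restrict (($) (vec n f)) {..<n} = f" if "f \<in> {..<n} \<rightarrow>\<^sub>E UNIV" for f
    using that by (intro PiE_ext[OF _ that]) simp_all
  show "vec n (restrict (($) v) {..<n}) = v" if "v \<in> carrier_vec n" for v
    using that by (intro eq_vecI) simp_all
qed

lemma finite_carrier_vec: "finite (carrier_vec n :: 'a :: finite vec set)"
  using bij_betw_finite[OF bij_betw_vec[of n, where ?'a = 'a]] by (simp add: finite_PiE)

lemma card_carrier_vec: "card (carrier_vec n :: 'a :: finite vec set) = CARD('a) ^ n"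
  using bij_betw_same_card[OF bij_betw_vec[of n, where ?'a = 'a]] by (simp add: card_PiE)

lemma subspace_vec_iff:
  "VectorSpace.subspace class_ring W (module_vec TYPE('a :: field) n) \<longleftrightarrow>
     W \<subseteq> carrier_vec n \<and> 0\<^sub>v n \<in> W \<and> (\<forall>v\<in>W. \<forall>w\<in>W. v + w \<in> W) \<and> (\<forall>a. \<forall>v\<in>W. a \<cdot>\<^sub>v v \<in> W)"
  unfolding VectorSpace.subspace_def submodule_def
  by (simp add: vec_vs vec_module module_vec_simps class_ring_simps) blast

context vec_space
begin

text \<open>A finite \<open>W\<close> generates itself, so it has a basis in the structure with
  carrier \<open>W\<close>. Spans and combinations formed there agree with the ambient ones, and
  uniqueness of representation becomes the bijection with coefficient functions.\<close>

lemma subspace_basis: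
  assumes W: "VectorSpace.subspace class_ring W V" and fin: "finite W"
  obtains B where "finite B" "B \<subseteq> W" "span B = W" "card B = subspace_dim n W"
    "bij_betw (\<lambda>a. lincomb a B) (B \<rightarrow>\<^sub>E UNIV) W"
proof -
  have sub: "submodule class_ring W V" using W by simp
  interpret W: vectorspace class_ring "vs W" by (rule subspace_is_vs[OF W])
  have "W \<subseteq> W.span W" using W.in_own_span[of W] by simp
  moreover have "W.span W \<subseteq> W" using W.span_is_subset2[of W] by simp
  ultimately have "W.fin_dim" unfolding W.fin_dim_def using fin by (intro exI[of _ W]) auto
  then obtain B where B: "finite B" "W.basis B" using W.finite_basis_exists by blast
  then have BW: "B \<subseteq> W" and gen: "W.span B = W" by (auto simp: W.basis_def)
  have lc: "W.lincomb a B = lincomb a B" for a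
    using lincomb_not_depend[OF B(1) BW sub] by (simp add: class_ring_simps)
  have uni: "\<exists>!a. a \<in> B \<rightarrow>\<^sub>E UNIV \<and> lincomb a B = v" if "v \<in> W" for v
    using W.basis_criterion[of B] B BW that by (simp add: lc class_ring_simps)
  have mem: "lincomb a B \<in> W" for a
    using W.lincomb_closed[of B a] BW by (simp add: lc class_ring_simps)
  show thesis
  proof
    show "span B = W" using span_li_not_depend(1)[OF BW sub] gen by simp
    show "card B = subspace_dim n W" using W.dim_basis[OF B] by (simp add: subspace_dim_def)
    show "bij_betw (\<lambda>a. lincomb a B) (B \<rightarrow>\<^sub>E UNIV) W"
      unfolding bij_betw_def inj_on_def using uni mem by blast
  qed (use B BW in auto)
qed

end

text \<open>Vectors correspond to coefficient functions on a basis. This turns every comparison of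
  dimensions into one of cardinalities.\<close>

lemma card_subspace:
  fixes W :: "'a :: {field, finite} vec set"
  assumes W: "VectorSpace.subspace class_ring W (module_vec TYPE('a) n)"
  shows "card W = CARD('a) ^ subspace_dim n W"
proof -
  interpret vec_space "TYPE('a)" n .
  have "finite W"
    using W finite_carrier_vec[of n] by (auto simp: subspace_vec_iff intro: finite_subset)
  then obtain B where B: "finite B" "card B = subspace_dim n W"
    "bij_betw (\<lambda>a. lincomb a B) (B \<rightarrow>\<^sub>E UNIV) W"
    using subspace_basis[OF W] by metis
  have "card W = card (B \<rightarrow>\<^sub>E (UNIV :: 'a set))" using bij_betw_same_card[OF B(3)] by (rule sym)
  also have "\<dots> = CARD('a) ^ subspace_dim n W" using B by (simp add: card_PiE)
  finally show ?thesis .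
qed

text \<open>Counting substitute for duality: products with \<open>W\<close> are determined by those
  with a basis of \<open>W\<close>, which leaves only \<open>card W\<close> patterns of values. A
  collision makes \<open>u - u'\<close> a nonzero vector orthogonal to \<open>W\<close>.\<close>

lemma pigeonhole_scalar_prod:
  fixes W :: "'a :: {field, finite} vec set"
  assumes W: "VectorSpace.subspace class_ring W (module_vec TYPE('a) n)"
    and U: "U \<subseteq> carrier_vec n" and card: "card W < card U"
  obtains u u' where "u \<in> U" "u' \<in> U" "u \<noteq> u'" "\<And>w. w \<in> W \<Longrightarrow> w \<bullet> u = w \<bullet> u'"
proof -
  interpret vec_space "TYPE('a)" n .
  have Wc: "W \<subseteq> carrier_vec n" using W by (auto simp: subspace_vec_iff)
  then have "finite W" using finite_carrier_vec finite_subset by blast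
  then obtain B where B: "finite B" "B \<subseteq> W" "span B = W" "card B = subspace_dim n W"
    using subspace_basis[OF W] by metis
  let ?g = "\<lambda>u. restrict (\<lambda>b. b \<bullet> u) B"
  have "\<not> inj_on ?g U"
  proof
    assume "inj_on ?g U"
    moreover have "?g ` U \<subseteq> B \<rightarrow>\<^sub>E UNIV" by auto
    moreover have "finite (B \<rightarrow>\<^sub>E (UNIV :: 'a set))" using B by (simp add: finite_PiE)
    ultimately have "card U \<le> card (B \<rightarrow>\<^sub>E (UNIV :: 'a set))" by (rule card_inj_on_le)
    then show False using card card_subspace[OF W] B by (simp add: card_PiE)
  qed
  then obtain u u' where u: "u \<in> U" "u' \<in> U" "u \<noteq> u'" and "?g u = ?g u'"
    by (auto simp: inj_on_def)
  then have eqB: "b \<bullet> u = b \<bullet> u'" if "b \<in> B" for b using that by (metis restrict_apply')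
  have uc: "u \<in> carrier_vec n" "u' \<in> carrier_vec n" using u U by auto
  have Bc: "B \<subseteq> carrier_vec n" using B Wc by auto
  \<comment> \<open>Orthogonality passes from \<open>B\<close> to its span, so agreement on the
    basis becomes agreement on \<open>W\<close>.\<close>
  have "u - u' \<in> orthogonal_complement B"
    unfolding orthogonal_complement_def
  proof (intro CollectI conjI ballI)
    fix b assume b: "b \<in> B"
    then have bc: "b \<in> carrier_vec n" using Bc by blast
    have "(u - u') \<bullet> b = u \<bullet> b - u' \<bullet> b" using uc bc by (simp add: minus_scalar_prod_distrib)
    also have "\<dots> = 0" using eqB[OF b] comm_scalar_prod[OF bc] uc by simp
    finally show "(u - u') \<bullet> b = 0" .
  qed (use uc in simp)
  then have *: "u - u' \<in> orthogonal_complement W" using Bc B(3) in_orthogonal_complement_span by metis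
  have "w \<bullet> u = w \<bullet> u'" if "w \<in> W" for w
  proof -
    have w: "w \<in> carrier_vec n" using that Wc by auto
    have "(u - u') \<bullet> w = 0" using * that by (simp add: orthogonal_complement_def)
    then have "u \<bullet> w = u' \<bullet> w" using uc w by (simp add: minus_scalar_prod_distrib)
    then show ?thesis using comm_scalar_prod[OF w] uc by simp
  qed
  then show thesis using that u by blast
qed

text \<open>With a trivial intersection, addition would embed \<open>W \<times> W'\<close> into the
  whole space, which has too few elements.\<close>

lemma subspaces_meet:
  fixes W W' :: "'a :: {field, finite} vec set"
  assumes W: "VectorSpace.subspace class_ring W (module_vec TYPE('a) n)"
    and W': "VectorSpace.subspace class_ring W' (module_vec TYPE('a) n)"
    and dim: "n < subspace_dim n W + subspace_dim n W'"
  shows "W \<inter> W' \<noteq> {0\<^sub>v n}"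
proof
  assume meet: "W \<inter> W' = {0\<^sub>v n}"
  interpret vec_space "TYPE('a)" n .
  have Wc: "W \<subseteq> carrier_vec n" "W' \<subseteq> carrier_vec n" using W W' by (auto simp: subspace_vec_iff)
  have diff: "w - w' \<in> Z" if "VectorSpace.subspace class_ring Z V" "w \<in> Z" "w' \<in> Z" for w w' Z
  proof -
    have "w \<in> carrier_vec n" "w' \<in> carrier_vec n" using that unfolding subspace_vec_iff by blast+
    then have "w - w' = w + (-1) \<cdot>\<^sub>v w'" by (intro eq_vecI) simp_all
    then show ?thesis using that unfolding subspace_vec_iff by simp
  qed
  have "inj_on (\<lambda>(w, w'). w + w') (W \<times> W')"
  proof (rule inj_onI, clarify)
    fix a b c d assume abcd: "a \<in> W" "b \<in> W'" "c \<in> W" "d \<in> W'" and eq: "a + b = c + d"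
    have carr: "a \<in> carrier_vec n" "b \<in> carrier_vec n" "c \<in> carrier_vec n" "d \<in> carrier_vec n"
      using abcd Wc by auto
    have "a - c = d - b"
    proof (rule eq_vecI)
      fix i assume i: "i < dim_vec (d - b)"
      have "(a + b) $ i = (c + d) $ i" using eq by simp
      then show "(a - c) $ i = (d - b) $ i" using i carr by (simp add: algebra_simps)
    qed (use carr in auto)
    \<comment> \<open>The left side of the equation lies in \<open>W\<close>, the right side in
      \<open>W'\<close>.\<close>
    then have "a - c \<in> W \<inter> W'" using diff[OF W, of a c] diff[OF W', of d b] abcd by simp
    then have 0: "a - c = 0\<^sub>v n" using meet by blast
    then have 1: "d - b = 0\<^sub>v n" using \<open>a - c = d - b\<close> by simp
    have "a $ i = c $ i \<and> b $ i = d $ i" if "i < n" for i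
      using arg_cong[OF 0, of "\<lambda>v. v $ i"] arg_cong[OF 1, of "\<lambda>v. v $ i"] carr that by simp
    moreover have "v = w" if "v \<in> carrier_vec n" "w \<in> carrier_vec n" "\<And>i. i < n \<Longrightarrow> v $ i = w $ i"
      for v w :: "'a vec"
      using that by (intro eq_vecI) simp_all
    ultimately show "a = c \<and> b = d" using carr by blast
  qed
  moreover have "(\<lambda>(w, w'). w + w') ` (W \<times> W') \<subseteq> carrier_vec n" using Wc by auto
  ultimately have "card (W \<times> W') \<le> card (carrier_vec n :: 'a vec set)"
    using finite_carrier_vec by (rule card_inj_on_le)
  then have "CARD('a) ^ (subspace_dim n W + subspace_dim n W') \<le> CARD('a) ^ n"
    by (simp add: card_cartesian_product card_subspace[OF W] card_subspace[OF W'] card_carrier_vec power_add)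
  moreover have "1 < CARD('a)"
    using card_mono[of "UNIV :: 'a set" "{0, 1}"] by simp
  ultimately show False using dim by (simp add: power_increasing_iff)
qed

section \<open>Frobenius powers in finite fields\<close>

text \<open>Multiplication by a nonzero \<open>x\<close> permutes the nonzero elements, so their
  product is unchanged by the factor \<open>x ^ (CARD('a) - 1)\<close>.\<close>

lemma finite_field_pow_card: "x ^ CARD('a) = (x :: 'a :: {field, finite})"
proof (cases "x = 0")
  case False
  let ?P = "\<Prod>y\<in>UNIV - {0 :: 'a}. y"
  have "?P = (\<Prod>y\<in>UNIV - {0}. x * y)"
    by (rule prod.reindex_bij_witness[of _ "\<lambda>y. x * y" "\<lambda>y. y / x"]) (use False in auto)
  also have "\<dots> = x ^ (CARD('a) - 1) * ?P" by (simp add: prod.distrib)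
  finally have "x ^ (CARD('a) - 1) = 1" by simp
  then have "x ^ Suc (CARD('a) - 1) = x" by (simp only: power_Suc mult_1_right)
  then show ?thesis by simp
qed (simp add: power_0_left)

text \<open>The characteristic is a prime dividing a power of \<open>p\<close>, hence
  \<open>p\<close> itself, and \<open>q ^ i\<close> is a power of \<open>p\<close>.\<close>

lemma finite_field_freshmans_dream:
  fixes x y :: "'a :: {field, finite}"
  assumes q: "primepow q" and card: "CARD('a) = q ^ m"
  shows "(x + y) ^ q ^ i = x ^ q ^ i + y ^ q ^ i"
proof -
  obtain p e where p: "prime p" "q = p ^ e" using q by (auto simp: primepow_def)
  have "CHAR('a) dvd p ^ (e * m)" using CHAR_dvd_CARD[where 'a = 'a] p by (simp add: card power_mult)
  moreover have "prime CHAR('a)" by (rule prime_CHAR_semidom) (simp add: finite_imp_CHAR_pos)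
  ultimately have "CHAR('a) = p" using p by (metis prime_dvd_power primes_dvd_imp_eq)
  then show ?thesis using p by (intro freshmans_dream'[of _ "e * i"]) (simp_all add: power_mult)
qed

subsection \<open>Rank supports\<close>

locale finite_field_extension = field_hom \<iota>
  for \<iota> :: "'a :: {field, finite} \<Rightarrow> 'b :: {field, finite}" +
  fixes \<Gamma> :: "'b list" and q m :: nat
  assumes primepow_q: "primepow q"
    and card_base: "CARD('a) = q" and card_ext: "CARD('b) = q ^ m"
    and basis: "ext_basis \<iota> \<Gamma>"
begin

sublocale ext: vector_space "ext_scale \<iota>"
  by (rule vector_space_ext_scale) unfold_locales

lemma q_gt_1: "1 < q"
  using primepow_q primepow_gt_Suc_0[of q] by simp

lemma sum_basis_eq:
  "(\<Sum>i<length \<Gamma>. \<iota> (g (\<Gamma> ! i)) * \<Gamma> ! i) = (\<Sum>b\<in>set \<Gamma>. ext_scale \<iota> (g b) b)"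
proof -
  have "bij_betw ((!) \<Gamma>) {..<length \<Gamma>} (set \<Gamma>)"
    using basis by (intro bij_betw_nth) (auto simp: ext_basis_def)
  then show ?thesis by (simp add: ext_scale_def flip: sum.reindex_bij_betw)
qed

lemma sum_representation:
  "(\<Sum>i<length \<Gamma>. \<iota> (ext.representation (set \<Gamma>) y (\<Gamma> ! i)) * \<Gamma> ! i) = y"
  unfolding sum_basis_eq
  using basis by (intro ext.sum_representation_eq) (auto simp: ext_basis_def)

lemma basis_indpt:
  assumes sum: "(\<Sum>i<length \<Gamma>. \<iota> (u i) * \<Gamma> ! i) = 0" and i: "i < length \<Gamma>"
  shows "u i = 0"
proof -
  have dist: "distinct \<Gamma>" using basis by (simp add: ext_basis_def)
  then have inj: "inj_on ((!) \<Gamma>) {..<length \<Gamma>}" by (simp add: inj_on_nth)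
  \<comment> \<open>Coefficients indexed by positions become a function of basis elements, which is
    well defined because \<open>\<Gamma>\<close> is distinct.\<close>
  let ?g = "\<lambda>b. u (the_inv_into {..<length \<Gamma>} ((!) \<Gamma>) b)"
  have g: "?g (\<Gamma> ! j) = u j" if "j < length \<Gamma>" for j
    using that inj by (simp add: the_inv_into_f_f)
  have "(\<Sum>b\<in>set \<Gamma>. ext_scale \<iota> (?g b) b) = 0"
    using sum g by (simp flip: sum_basis_eq)
  then have "?g (\<Gamma> ! i) = 0"
    using basis i ext.independentD[of "set \<Gamma>" "set \<Gamma>" ?g "\<Gamma> ! i"] by (auto simp: ext_basis_def)
  then show ?thesis using g i by simp
qed

text \<open>Coordinate tuples biject with the large field, so
  \<open>q ^ length \<Gamma> = q ^ m\<close>.\<close>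

lemma length_basis: "length \<Gamma> = m"
proof -
  let ?F = "{..<length \<Gamma>} \<rightarrow>\<^sub>E (UNIV :: 'a set)"
  let ?h = "\<lambda>u. \<Sum>i<length \<Gamma>. \<iota> (u i) * \<Gamma> ! i"
  have "inj_on ?h ?F"
  proof (rule inj_onI)
    fix u v assume u: "u \<in> ?F" and v: "v \<in> ?F" and eq: "?h u = ?h v"
    have "(\<Sum>i<length \<Gamma>. \<iota> (u i - v i) * \<Gamma> ! i) = ?h u - ?h v"
      by (simp only: hom_minus left_diff_distrib sum_subtractf)
    then have "(\<Sum>i<length \<Gamma>. \<iota> (u i - v i) * \<Gamma> ! i) = 0" using eq by simp
    then have "u i - v i = 0" if "i < length \<Gamma>" for i using that by (rule basis_indpt)
    then show "u = v" by (intro PiE_ext[OF u v]) simp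
  qed
  moreover have "y \<in> ?h ` ?F" for y
  proof (rule image_eqI)
    let ?u = "restrict (\<lambda>i. ext.representation (set \<Gamma>) y (\<Gamma> ! i)) {..<length \<Gamma>}"
    have "?h ?u = (\<Sum>i<length \<Gamma>. \<iota> (ext.representation (set \<Gamma>) y (\<Gamma> ! i)) * \<Gamma> ! i)" by simp
    also have "\<dots> = y" by (rule sum_representation)
    finally show "y = ?h ?u" by (rule sym)
    show "?u \<in> ?F" by (rule restrict_PiE_iff[THEN iffD2]) simp
  qed
  ultimately have "bij_betw ?h ?F UNIV" unfolding bij_betw_def by blast
  then have "card ?F = CARD('b)" by (rule bij_betw_same_card)
  then have "q ^ length \<Gamma> = q ^ m" by (simp add: card_PiE card_base card_ext)
  then show ?thesis using q_gt_1 by simp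
qed

section \<open>Pairing a vector with coefficients from the small field\<close>

text \<open>As \<open>u\<close> varies, the values form the span of the entries of \<open>x\<close>
  over the small field, a basis-free counterpart of the column space of the coordinate
  matrix.\<close>

definition ext_prod :: "'b vec \<Rightarrow> 'a vec \<Rightarrow> 'b" where
  "ext_prod x u = (\<Sum>j<dim_vec x. \<iota> (u $ j) * x $ j)"

lemma ext_prod_diff:
  assumes "u \<in> carrier_vec (dim_vec x)" "v \<in> carrier_vec (dim_vec x)"
  shows "ext_prod x (u - v) = ext_prod x u - ext_prod x v"
proof -
  have "ext_prod x (u - v) = (\<Sum>j<dim_vec x. \<iota> (u $ j - v $ j) * x $ j)"
    unfolding ext_prod_def using assms by (intro sum.cong) auto
  also have "\<dots> = ext_prod x u - ext_prod x v"
    by (simp only: ext_prod_def hom_minus left_diff_distrib sum_subtractf)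
  finally show ?thesis .
qed

lemma rank_support_subspace:
  "VectorSpace.subspace class_ring (rank_support \<iota> \<Gamma> x) (module_vec TYPE('a) (dim_vec x))"
proof -
  interpret vec_space "TYPE('a)" "dim_vec x" .
  have "set (rows (coord_mat \<iota> \<Gamma> x)) \<subseteq> carrier_vec (dim_vec x)"
    using rows_carrier[of "coord_mat \<iota> \<Gamma> x"] by (simp add: coord_mat_def)
  then show ?thesis unfolding rank_support_def row_space_def by (intro span_is_subspace) simp
qed

lemma row_in_rank_support:
  assumes "i < length \<Gamma>"
  shows "row (coord_mat \<iota> \<Gamma> x) i \<in> rank_support \<iota> \<Gamma> x"
proof -
  interpret vec_space "TYPE('a)" "dim_vec x" .
  have sub: "set (rows (coord_mat \<iota> \<Gamma> x)) \<subseteq> carrier_vec (dim_vec x)"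
    using rows_carrier[of "coord_mat \<iota> \<Gamma> x"] by (simp add: coord_mat_def)
  have "row (coord_mat \<iota> \<Gamma> x) i \<in> set (rows (coord_mat \<iota> \<Gamma> x))"
    using assms by (auto simp: rows_def coord_mat_def)
  then show ?thesis unfolding rank_support_def row_space_def using in_own_span[of "set (rows (coord_mat \<iota> \<Gamma> x))"] sub by auto
qed

text \<open>Expanding each entry of \<open>x\<close> in \<open>\<Gamma>\<close> and exchanging the
  sums shows that the coordinates of the pairing are the products of the rows with
  \<open>u\<close>.\<close>

lemma ext_prod_conv_rows:
  assumes u: "u \<in> carrier_vec (dim_vec x)"
  shows "ext_prod x u = (\<Sum>i<length \<Gamma>. \<iota> (row (coord_mat \<iota> \<Gamma> x) i \<bullet> u) * \<Gamma> ! i)"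
proof -
  let ?A = "\<lambda>i j. ext.representation (set \<Gamma>) (x $ j) (\<Gamma> ! i)"
  have row: "row (coord_mat \<iota> \<Gamma> x) i \<bullet> u = (\<Sum>j<dim_vec x. ?A i j * u $ j)" if "i < length \<Gamma>" for i
    using that u by (simp add: scalar_prod_def coord_mat_def lessThan_atLeast0)
  have "ext_prod x u = (\<Sum>j<dim_vec x. \<iota> (u $ j) * (\<Sum>i<length \<Gamma>. \<iota> (?A i j) * \<Gamma> ! i))"
    by (simp add: ext_prod_def sum_representation)
  also have "\<dots> = (\<Sum>i<length \<Gamma>. (\<Sum>j<dim_vec x. \<iota> (?A i j) * \<iota> (u $ j)) * \<Gamma> ! i)"
    unfolding sum_distrib_left sum_distrib_right by (subst sum.swap) (simp add: ac_simps)
  also have "\<dots> = (\<Sum>i<length \<Gamma>. \<iota> (row (coord_mat \<iota> \<Gamma> x) i \<bullet> u) * \<Gamma> ! i)"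
    by (intro sum.cong) (simp_all add: row hom_distribs)
  finally show ?thesis .
qed

lemma ext_prod_eqI:
  assumes "u \<in> carrier_vec (dim_vec x)" "v \<in> carrier_vec (dim_vec x)"
    and "\<And>w. w \<in> rank_support \<iota> \<Gamma> x \<Longrightarrow> w \<bullet> u = w \<bullet> v"
  shows "ext_prod x u = ext_prod x v"
  using assms row_in_rank_support by (simp add: ext_prod_conv_rows)

text \<open>Column rank is at most row rank: via \<open>\<Gamma>\<close>, the products \<open>ext_prod x u\<close> are the combinations of
  the columns of the coordinate matrix.\<close>

lemma card_ext_prod_image_le:
  "card (ext_prod x ` carrier_vec (dim_vec x)) \<le> card (rank_support \<iota> \<Gamma> x)"
proof (rule ccontr)
  assume less: "\<not> ?thesis"
  \<comment> \<open>\<open>U\<close> selects one preimage for each value, so two members with equal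
    products against the support give a contradiction.\<close>
  obtain U where U: "U \<subseteq> carrier_vec (dim_vec x)" "inj_on (ext_prod x) U"
    "ext_prod x ` carrier_vec (dim_vec x) = ext_prod x ` U"
    by (metis subset_image_inj subset_refl)
  then have "card (rank_support \<iota> \<Gamma> x) < card U" using less by (simp add: card_image)
  then obtain u v where "u \<in> U" "v \<in> U" "u \<noteq> v" "\<And>w. w \<in> rank_support \<iota> \<Gamma> x \<Longrightarrow> w \<bullet> u = w \<bullet> v"
    using pigeonhole_scalar_prod[OF rank_support_subspace U(1)] by metis
  moreover from this have "ext_prod x u = ext_prod x v" using U by (intro ext_prod_eqI) auto
  ultimately show False using U(2) inj_onD by metis
qed

section \<open>Criterion for nondegeneracy\<close>

text \<open>The sum of the supports is a subspace. If it were proper, two distinct vectors would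
  agree against it, and their nonzero difference would be annihilated by every codeword.\<close>

lemma nondegenerate_codeI:
  assumes C: "C \<subseteq> carrier_vec n"
    and ker: "\<And>u. u \<in> carrier_vec n \<Longrightarrow> (\<And>c. c \<in> C \<Longrightarrow> ext_prod c u = 0) \<Longrightarrow> u = 0\<^sub>v n"
  shows "nondegenerate_code \<iota> \<Gamma> n C"
proof -
  define W where "W = {finsum_vec TYPE('a) n v C | v. \<forall>c\<in>C. v c \<in> rank_support \<iota> \<Gamma> c}"
  have supp: "0\<^sub>v n \<in> rank_support \<iota> \<Gamma> c" "rank_support \<iota> \<Gamma> c \<subseteq> carrier_vec n"
    "\<And>v w. v \<in> rank_support \<iota> \<Gamma> c \<Longrightarrow> w \<in> rank_support \<iota> \<Gamma> c \<Longrightarrow> v + w \<in> rank_support \<iota> \<Gamma> c"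
    "\<And>a v. v \<in> rank_support \<iota> \<Gamma> c \<Longrightarrow> a \<cdot>\<^sub>v v \<in> rank_support \<iota> \<Gamma> c" if "c \<in> C" for c
  proof -
    have "dim_vec c = n" using C that by auto
    then have "VectorSpace.subspace class_ring (rank_support \<iota> \<Gamma> c) (module_vec TYPE('a) n)"
      using rank_support_subspace[of c] by simp
    then show "0\<^sub>v n \<in> rank_support \<iota> \<Gamma> c" "rank_support \<iota> \<Gamma> c \<subseteq> carrier_vec n"
      "\<And>v w. v \<in> rank_support \<iota> \<Gamma> c \<Longrightarrow> w \<in> rank_support \<iota> \<Gamma> c \<Longrightarrow> v + w \<in> rank_support \<iota> \<Gamma> c"
      "\<And>a v. v \<in> rank_support \<iota> \<Gamma> c \<Longrightarrow> a \<cdot>\<^sub>v v \<in> rank_support \<iota> \<Gamma> c"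
      unfolding subspace_vec_iff by blast+
  qed
  have carr: "v \<in> C \<rightarrow> carrier_vec n" if "\<forall>c\<in>C. v c \<in> rank_support \<iota> \<Gamma> c" for v
    using supp(2) that by blast
  have finC: "finite C" using C finite_carrier_vec finite_subset by blast
  \<comment> \<open>\<open>WI\<close> and \<open>WE\<close> describe membership by coordinates, so
    that closure properties reduce to identities of ordinary sums.\<close>
  have WI: "w \<in> W" if "\<forall>c\<in>C. v c \<in> rank_support \<iota> \<Gamma> c" "w \<in> carrier_vec n"
    "\<And>i. i < n \<Longrightarrow> w $ i = (\<Sum>c\<in>C. v c $ i)" for v w
  proof -
    have "w = finsum_vec TYPE('a) n v C"
      using that(2,3) finsum_vec_closed[OF carr[OF that(1)]]
      by (intro eq_vecI) (simp_all add: index_finsum_vec[OF finC _ carr[OF that(1)]])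
    then show ?thesis using that unfolding W_def by blast
  qed
  have WE: "\<exists>v. (\<forall>c\<in>C. v c \<in> rank_support \<iota> \<Gamma> c) \<and> w \<in> carrier_vec n \<and> (\<forall>i<n. w $ i = (\<Sum>c\<in>C. v c $ i))"
    if "w \<in> W" for w
  proof -
    from that obtain v where v: "\<forall>c\<in>C. v c \<in> rank_support \<iota> \<Gamma> c" and w: "w = finsum_vec TYPE('a) n v C"
      unfolding W_def by blast
    then show ?thesis
      using finsum_vec_closed[OF carr[OF v]] by (intro exI[of _ v]) (simp add: index_finsum_vec[OF finC _ carr[OF v]])
  qed
  have dim: "dim_vec (v c) = n" if "\<forall>c\<in>C. v c \<in> rank_support \<iota> \<Gamma> c" "c \<in> C" for v c
    using funcset_mem[OF carr[OF that(1)] that(2)] by (rule carrier_vecD)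
  have sub: "VectorSpace.subspace class_ring W (module_vec TYPE('a) n)"
    unfolding subspace_vec_iff
  proof (intro conjI ballI allI)
    show "W \<subseteq> carrier_vec n" using WE by blast
    show "0\<^sub>v n \<in> W" by (rule WI[of "\<lambda>_. 0\<^sub>v n"]) (simp_all add: supp)
  next
    fix v w assume v: "v \<in> W" and w: "w \<in> W"
    from WE[OF v] obtain f where f: "\<forall>c\<in>C. f c \<in> rank_support \<iota> \<Gamma> c" "v \<in> carrier_vec n"
      "\<forall>i<n. v $ i = (\<Sum>c\<in>C. f c $ i)"
      by (elim exE conjE)
    from WE[OF w] obtain g where g: "\<forall>c\<in>C. g c \<in> rank_support \<iota> \<Gamma> c" "w \<in> carrier_vec n"
      "\<forall>i<n. w $ i = (\<Sum>c\<in>C. g c $ i)"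
      by (elim exE conjE)
    from f g show "v + w \<in> W"
      by (intro WI[of "\<lambda>c. f c + g c"]) (simp_all add: supp dim sum.distrib)
  next
    fix a v assume v: "v \<in> W"
    from WE[OF v] obtain f where "\<forall>c\<in>C. f c \<in> rank_support \<iota> \<Gamma> c" "v \<in> carrier_vec n"
      "\<forall>i<n. v $ i = (\<Sum>c\<in>C. f c $ i)"
      by (elim exE conjE)
    then show "a \<cdot>\<^sub>v v \<in> W"
      by (intro WI[of "\<lambda>c. a \<cdot>\<^sub>v f c"]) (simp_all add: supp dim sum_distrib_left)
  qed
  have supp_W: "rank_support \<iota> \<Gamma> c \<subseteq> W" if c: "c \<in> C" for c
  proof
    fix w assume w: "w \<in> rank_support \<iota> \<Gamma> c"
    show "w \<in> W"
    \<comment> \<open>A single support is reached by choosing the zero vector from all the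
      others.\<close>
    proof (rule WI[of "\<lambda>c'. if c' = c then w else 0\<^sub>v n"])
      fix i assume "i < n"
      then have "(\<Sum>c'\<in>C. (if c' = c then w else 0\<^sub>v n) $ i) = (\<Sum>c'\<in>C. if c' = c then w $ i else 0)"
        by (intro sum.cong) auto
      then show "w $ i = (\<Sum>c'\<in>C. (if c' = c then w else 0\<^sub>v n) $ i)" using c finC by simp
    qed (use w c supp(1,2) in \<open>simp_all add: subset_iff\<close>)
  qed
  have "W = carrier_vec n"
  proof (rule ccontr)
    assume "W \<noteq> carrier_vec n"
    then have "card W < card (carrier_vec n :: 'a vec set)"
      using sub finite_carrier_vec by (intro psubset_card_mono) (auto simp: subspace_vec_iff)
    then obtain u v where uv: "u \<in> carrier_vec n" "v \<in> carrier_vec n" "u \<noteq> v"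
      "\<And>w. w \<in> W \<Longrightarrow> w \<bullet> u = w \<bullet> v"
      using pigeonhole_scalar_prod[OF sub subset_refl] by metis
    have "ext_prod c (u - v) = 0" if "c \<in> C" for c
    proof -
      have "ext_prod c u = ext_prod c v" using that uv C supp_W by (intro ext_prod_eqI) auto
      then show ?thesis using that uv C by (subst ext_prod_diff) auto
    qed
    then have 0: "u - v = 0\<^sub>v n" using uv by (intro ker) auto
    have "u $ i = v $ i" if "i < n" for i
      using arg_cong[OF 0, of "\<lambda>w. w $ i"] uv that by simp
    then have "u = v" using uv by (intro eq_vecI) simp_all
    then show False using uv by simp
  qed
  then show ?thesis unfolding nondegenerate_code_def W_def .
qed

subsection \<open>Extended Gabidulin codes\<close>

text \<open>The power \<open>q ^ i\<close> is additive and fixes the image of the small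
  field.\<close>

lemma pow_q_sum:
  "(\<Sum>j\<in>A. \<iota> (a j) * g j) ^ q ^ i = (\<Sum>j\<in>A. \<iota> (a j) * g j ^ q ^ i)"
proof (induction A rule: infinite_finite_induct)
  case (insert j A)
  have "a j ^ q ^ i = a j"
    by (induction i) (simp_all add: power_mult finite_field_pow_card flip: card_base)
  then have "\<iota> (a j) ^ q ^ i = \<iota> (a j)" by (simp flip: hom_power)
  then show ?case using insert finite_field_freshmans_dream[OF primepow_q card_ext]
    by (simp add: power_mult_distrib)
\<comment> \<open>Over an empty or infinite index set both sums are 0, and
  \<open>0 ^ q ^ i = 0\<close> since the exponent is positive.\<close>
qed (use q_gt_1 in \<open>simp_all add: power_0_left\<close>)

definition lin_poly :: "'b vec \<Rightarrow> 'b \<Rightarrow> 'b" where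
  "lin_poly f y = (\<Sum>i<dim_vec f. f $ i * y ^ q ^ i)"

lemma lin_poly_sum:
  "lin_poly f (\<Sum>j\<in>A. \<iota> (a j) * g j) = (\<Sum>j\<in>A. \<iota> (a j) * lin_poly f (g j))"
  unfolding lin_poly_def pow_q_sum sum_distrib_left
  by (subst sum.swap) (simp add: ac_simps)

text \<open>A fibre is the root set of a nonzero polynomial of degree at most
  \<open>q ^ (k - 1)\<close>.\<close>

lemma card_lin_poly_fibre:
  assumes f: "f \<in> carrier_vec k" "f \<noteq> 0\<^sub>v k"
  shows "card {x. lin_poly f x = y} \<le> q ^ (k - 1)"
proof -
  define p where "p = (\<Sum>i<k. Polynomial.monom (f $ i) (q ^ i)) - [:y:]"
  have poly_p: "poly p x = lin_poly f x - y" for x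
    using f by (simp add: p_def lin_poly_def poly_sum poly_monom)
  have "f = 0\<^sub>v k" if "\<forall>i<k. f $ i = 0" using f that by (intro eq_vecI) simp_all
  then obtain i where i: "i < k" "f $ i \<noteq> 0" using f by blast
  \<comment> \<open>The exponent \<open>q ^ i\<close> is positive, so subtracting the constant
    \<open>y\<close> leaves this coefficient alone. As \<open>q > 1\<close>, distinct indices give
    distinct exponents, and nothing cancels.\<close>
  have "Polynomial.coeff [:y:] (q ^ i) = 0" using q_gt_1 by (cases "q ^ i") auto
  then have "Polynomial.coeff p (q ^ i) = (\<Sum>j<k. if j = i then f $ j else 0)"
    using q_gt_1 by (simp add: p_def coeff_sum)
  also have "\<dots> = f $ i" using i by simp
  finally have p0: "p \<noteq> 0" using i by auto
  have "Polynomial.degree (Polynomial.monom (f $ j) (q ^ j)) \<le> q ^ (k - 1)" if "j < k" for j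
  proof -
    have "q ^ j \<le> q ^ (k - 1)" using that q_gt_1 by (intro power_increasing) simp_all
    then show ?thesis using degree_monom_le order_trans by blast
  qed
  then have "Polynomial.degree p \<le> q ^ (k - 1)"
    unfolding p_def by (intro degree_diff_le degree_sum_le) simp_all
  moreover have "card {x. poly p x = 0} \<le> Polynomial.degree p" using p0 by (rule card_poly_roots_bound)
  moreover have "{x. poly p x = 0} = {x. lin_poly f x = y}" by (simp add: poly_p)
  ultimately show ?thesis by simp
qed

text \<open>The \<open>q ^ m\<close> field elements are distributed over fibres of size at most
  \<open>q ^ (k - 1)\<close>. The bound on \<open>k\<close> makes the truncated subtraction
  exact.\<close>

lemma card_range_lin_poly:
  assumes f: "f \<in> carrier_vec k" "f \<noteq> 0\<^sub>v k" and k: "k \<le> m + 1"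
  shows "q ^ (m - (k - 1)) \<le> card (range (lin_poly f))"
proof -
  have "(\<Union>y\<in>range (lin_poly f). {x. lin_poly f x = y}) = UNIV" by blast
  then have "q ^ m = card (\<Union>y\<in>range (lin_poly f). {x. lin_poly f x = y})" by (simp only: card_ext)
  also have "\<dots> \<le> (\<Sum>y\<in>range (lin_poly f). card {x. lin_poly f x = y})"
    by (rule card_UN_le) simp
  also have "\<dots> \<le> card (range (lin_poly f)) * q ^ (k - 1)"
    using card_lin_poly_fibre[OF f]
      sum_bounded_above[of "range (lin_poly f)" "\<lambda>y. card {x. lin_poly f x = y}" "q ^ (k - 1)"]
    by (simp only: of_nat_id)
  finally have "q ^ (m - (k - 1)) * q ^ (k - 1) \<le> card (range (lin_poly f)) * q ^ (k - 1)"
    using k by (simp flip: power_add)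
  then show ?thesis using q_gt_1 by simp
qed

section \<open>The encoding map and its weights\<close>

text \<open>The vector \<open>f\<close> holds the message. The index \<open>j - m\<close> stays
  inside \<open>\<Gamma>\<close> as long as \<open>n \<le> 2 * m\<close>, and \<open>f $ 0\<close>
  is in range for messages of positive length, whence \<open>0 < k\<close> in the linearity
  lemmas.\<close>

definition codeword :: "nat \<Rightarrow> 'b vec \<Rightarrow> 'b vec" where
  "codeword n f = vec n (\<lambda>j. if j < m then lin_poly f (\<Gamma> ! j) else f $ 0 * \<Gamma> ! (j - m))"

lemma codeword_carrier [simp]: "codeword n f \<in> carrier_vec n"
  by (simp add: codeword_def)

lemma dim_codeword [simp]: "dim_vec (codeword n f) = n"
  by (simp add: codeword_def)

lemma codeword_add:
  assumes "0 < k" "f \<in> carrier_vec k" "g \<in> carrier_vec k"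
  shows "codeword n (f + g) = codeword n f + codeword n g"
proof (rule eq_vecI)
  fix j assume "j < dim_vec (codeword n f + codeword n g)"
  moreover have "lin_poly (f + g) y = lin_poly f y + lin_poly g y" for y
    using assms by (simp add: lin_poly_def distrib_right sum.distrib)
  ultimately show "codeword n (f + g) $ j = (codeword n f + codeword n g) $ j"
    using assms by (simp add: codeword_def distrib_right)
qed simp

lemma codeword_smult:
  assumes "0 < k" "f \<in> carrier_vec k"
  shows "codeword n (a \<cdot>\<^sub>v f) = a \<cdot>\<^sub>v codeword n f"
proof (rule eq_vecI)
  fix j assume "j < dim_vec (a \<cdot>\<^sub>v codeword n f)"
  moreover have "lin_poly (a \<cdot>\<^sub>v f) y = a * lin_poly f y" for y
    using assms by (simp add: lin_poly_def sum_distrib_left mult.assoc)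
  ultimately show "codeword n (a \<cdot>\<^sub>v f) $ j = (a \<cdot>\<^sub>v codeword n f) $ j"
    using assms by (simp add: codeword_def)
qed simp

lemma codeword_zero: "0 < k \<Longrightarrow> codeword n (0\<^sub>v k) = 0\<^sub>v n"
  by (rule eq_vecI) (auto simp: codeword_def lin_poly_def)

text \<open>Splitting the sum at position \<open>m\<close>, linearity of \<open>lin_poly f\<close>
  over the small field moves the first half inside the argument.\<close>

lemma ext_prod_codeword:
  assumes "m \<le> n"
  shows "ext_prod (codeword n f) u =
    lin_poly f (\<Sum>j<m. \<iota> (u $ j) * \<Gamma> ! j) + f $ 0 * (\<Sum>j<n - m. \<iota> (u $ (j + m)) * \<Gamma> ! j)"
proof -
  let ?h = "\<lambda>j. \<iota> (u $ j) * codeword n f $ j"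
  have "ext_prod (codeword n f) u = sum ?h {..<n}" by (simp add: ext_prod_def)
  also have "\<dots> = sum ?h {0..<m} + sum ?h {m..<n}"
    unfolding lessThan_atLeast0 using assms by (simp only: sum.atLeastLessThan_concat le0)
  also have "sum ?h {0..<m} = lin_poly f (\<Sum>j<m. \<iota> (u $ j) * \<Gamma> ! j)"
    unfolding lin_poly_sum lessThan_atLeast0 using assms by (intro sum.cong) (simp_all add: codeword_def)
  also have "sum ?h {m..<n} = (\<Sum>j<n - m. ?h (j + m))"
    using assms sum.shift_bounds_nat_ivl[of ?h 0 m "n - m"] by (simp add: lessThan_atLeast0)
  also have "\<dots> = f $ 0 * (\<Sum>j<n - m. \<iota> (u $ (j + m)) * \<Gamma> ! j)"
    unfolding sum_distrib_left by (intro sum.cong) (simp_all add: codeword_def)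
  finally show ?thesis .
qed

text \<open>Appended coordinates do not shrink the span of the entries, since they may be given
  coefficient zero.\<close>

lemma range_lin_poly_subset:
  assumes "m \<le> n"
  shows "range (lin_poly f) \<subseteq> ext_prod (codeword n f) ` carrier_vec n"
proof (rule image_subsetI)
  fix y
  \<comment> \<open>The coordinates of \<open>y\<close> in \<open>\<Gamma>\<close>, padded with
    zeros.\<close>
  define u where "u = vec n (\<lambda>j. if j < m then ext.representation (set \<Gamma>) y (\<Gamma> ! j) else 0)"
  have "(\<Sum>j<m. \<iota> (u $ j) * \<Gamma> ! j) = (\<Sum>j<m. \<iota> (ext.representation (set \<Gamma>) y (\<Gamma> ! j)) * \<Gamma> ! j)"
    using assms by (intro sum.cong) (simp_all add: u_def)
  also have "\<dots> = y" using sum_representation[of y] by (simp add: length_basis)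
  finally have 1: "(\<Sum>j<m. \<iota> (u $ j) * \<Gamma> ! j) = y" .
  have 2: "(\<Sum>j<n - m. \<iota> (u $ (j + m)) * \<Gamma> ! j) = 0"
    by (intro sum.neutral) (simp add: u_def)
  have "ext_prod (codeword n f) u = lin_poly f y"
    unfolding ext_prod_codeword[OF assms] 1 2 by simp
  moreover have "u \<in> carrier_vec n" by (simp add: u_def)
  ultimately show "lin_poly f y \<in> ext_prod (codeword n f) ` carrier_vec n" by (metis imageI)
qed

text \<open>A zero codeword would leave \<open>lin_poly f\<close> only one value, while
  \<open>k \<le> m\<close> guarantees at least \<open>q\<close>.\<close>

lemma codeword_nonzero:
  assumes f: "f \<in> carrier_vec k" "f \<noteq> 0\<^sub>v k" and k: "k \<le> m" and n: "m \<le> n"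
  shows "codeword n f \<noteq> 0\<^sub>v n"
proof
  assume "codeword n f = 0\<^sub>v n"
  then have "ext_prod (codeword n f) ` carrier_vec n \<subseteq> {0}" by (auto simp: ext_prod_def)
  then have "card (range (lin_poly f)) \<le> card {0 :: 'b}"
    using range_lin_poly_subset[OF n, of f] by (intro card_mono) auto
  moreover have "q ^ 1 \<le> q ^ (m - (k - 1))"
    using k q_gt_1 f by (intro power_increasing) (cases k, auto)
  ultimately show False using card_range_lin_poly[OF f] k q_gt_1 by simp
qed

text \<open>The range of \<open>lin_poly f\<close> bounds the span of the entries from below, and
  the support bounds it from above. Comparing exponents of \<open>q\<close> gives the rank.\<close>

lemma rank_weight_codeword:
  assumes f: "f \<in> carrier_vec k" "f \<noteq> 0\<^sub>v k" and k: "k \<le> m" and n: "m \<le> n"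
  shows "m - (k - 1) \<le> rank_weight \<iota> \<Gamma> (codeword n f)"
proof -
  let ?c = "codeword n f"
  have "q ^ (m - (k - 1)) \<le> card (range (lin_poly f))" using card_range_lin_poly[OF f] k by simp
  also have "\<dots> \<le> card (ext_prod ?c ` carrier_vec n)"
    using range_lin_poly_subset[OF n, of f] by (intro card_mono) auto
  also have "\<dots> \<le> card (rank_support \<iota> \<Gamma> ?c)" using card_ext_prod_image_le[of ?c] by simp
  also have "\<dots> = q ^ rank_weight \<iota> \<Gamma> ?c"
    using card_subspace[OF rank_support_subspace[of ?c]] by (simp add: rank_weight_def card_base)
  finally show ?thesis using q_gt_1 by (simp add: power_increasing_iff)
qed

section \<open>The code and its parameters\<close>

definition ext_gabidulin :: "nat \<Rightarrow> nat \<Rightarrow> 'b vec set" where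
  "ext_gabidulin n k = codeword n ` carrier_vec k"

lemma inj_on_codeword:
  assumes "0 < k" "k \<le> m" "m \<le> n"
  shows "inj_on (codeword n) (carrier_vec k)"
proof (rule inj_onI)
  fix f g :: "'b vec" assume f: "f \<in> carrier_vec k" and g: "g \<in> carrier_vec k"
    and eq: "codeword n f = codeword n g"
  \<comment> \<open>The difference is written with the scalar -1 so that additivity and homogeneity
    of the encoding apply.\<close>
  define h where "h = f + (-1) \<cdot>\<^sub>v g"
  have h: "h \<in> carrier_vec k" using f g by (simp add: h_def)
  have "codeword n h = codeword n f + (-1) \<cdot>\<^sub>v codeword n g"
    using codeword_add[of k f "(-1) \<cdot>\<^sub>v g" n] codeword_smult[of k g n "-1"] assms f g by (simp add: h_def)
  also have "\<dots> = 0\<^sub>v n" unfolding eq by (rule eq_vecI) simp_all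
  finally have h0: "h = 0\<^sub>v k" using codeword_nonzero[OF h] assms by blast
  have "f $ i = g $ i" if "i < k" for i
    using arg_cong[OF h0, of "\<lambda>v. v $ i"] that f g by (simp add: h_def)
  then show "f = g" using f g by (intro eq_vecI) simp_all
qed

lemma ext_gabidulin_subspace:
  assumes "0 < k"
  shows "VectorSpace.subspace class_ring (ext_gabidulin n k) (module_vec TYPE('b) n)"
  unfolding subspace_vec_iff ext_gabidulin_def
proof (intro conjI ballI allI)
  show "codeword n ` carrier_vec k \<subseteq> carrier_vec n" using codeword_carrier by (rule image_subsetI)
  show "0\<^sub>v n \<in> codeword n ` carrier_vec k"
    using codeword_zero[OF assms] zero_carrier_vec by (rule image_eqI[OF sym])
next
  fix v w assume v: "v \<in> codeword n ` carrier_vec k" and w: "w \<in> codeword n ` carrier_vec k"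
  obtain f where f: "v = codeword n f" "f \<in> carrier_vec k" using v by (rule imageE)
  obtain g where g: "w = codeword n g" "g \<in> carrier_vec k" using w by (rule imageE)
  show "v + w \<in> codeword n ` carrier_vec k"
    unfolding f(1) g(1) codeword_add[OF assms f(2) g(2), symmetric]
    using add_carrier_vec[OF f(2) g(2)] by (rule imageI)
next
  fix a v assume v: "v \<in> codeword n ` carrier_vec k"
  obtain f where f: "v = codeword n f" "f \<in> carrier_vec k" using v by (rule imageE)
  show "a \<cdot>\<^sub>v v \<in> codeword n ` carrier_vec k"
    unfolding f(1) codeword_smult[OF assms f(2), symmetric]
    using smult_carrier_vec[THEN iffD2, OF f(2)] by (rule imageI)
qed

text \<open>The encoding is injective, so the code has as many elements as there are messages of
  length \<open>k\<close>.\<close>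

lemma subspace_dim_ext_gabidulin:
  assumes "0 < k" "k \<le> m" "m \<le> n"
  shows "subspace_dim n (ext_gabidulin n k) = k"
proof -
  have "CARD('b) ^ subspace_dim n (ext_gabidulin n k) = card (ext_gabidulin n k)"
    using card_subspace[OF ext_gabidulin_subspace[OF assms(1)]] by (rule sym)
  also have "\<dots> = CARD('b) ^ k"
    unfolding ext_gabidulin_def using inj_on_codeword[OF assms] by (simp add: card_image card_carrier_vec)
  finally have "(q ^ m) ^ subspace_dim n (ext_gabidulin n k) = (q ^ m) ^ k" by (simp add: card_ext)
  moreover have "1 < q ^ m" using q_gt_1 assms by (intro one_less_power) simp_all
  ultimately show ?thesis by (simp only: power_inject_exp)
qed

lemma lin_poly_unit_vec: "i < k \<Longrightarrow> lin_poly (unit_vec k i) y = y ^ q ^ i"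
  by (simp add: lin_poly_def unit_vec_def if_distrib[of "\<lambda>c. c * _"] cong: if_cong)

text \<open>Two messages suffice as tests. Then \<open>y\<close> and \<open>z\<close> both vanish,
  and they are combinations of basis elements whose coefficients are the entries of
  \<open>u\<close>.\<close>

lemma ext_gabidulin_kernel:
  assumes k: "2 \<le> k" and n: "m \<le> n" "n \<le> 2 * m" and u: "u \<in> carrier_vec n"
    and 0: "\<And>c. c \<in> ext_gabidulin n k \<Longrightarrow> ext_prod c u = 0"
  shows "u = 0\<^sub>v n"
proof -
  define y where "y = (\<Sum>j<m. \<iota> (u $ j) * \<Gamma> ! j)"
  define z where "z = (\<Sum>j<n - m. \<iota> (u $ (j + m)) * \<Gamma> ! j)"
  have *: "lin_poly f y + f $ 0 * z = 0" if "f \<in> carrier_vec k" for f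
    using 0[of "codeword n f"] that ext_prod_codeword[OF n(1), of f u]
    by (simp add: ext_gabidulin_def y_def z_def)
  \<comment> \<open>The message \<open>unit_vec k 1\<close>, available since
    \<open>k \<ge> 2\<close>, is blind to \<open>z\<close>. Once \<open>y = 0\<close>, the message
    \<open>unit_vec k 0\<close> isolates \<open>z\<close>.\<close>
  have "y ^ q ^ 1 = 0" using *[of "unit_vec k 1"] k by (simp add: lin_poly_unit_vec)
  then have y: "y = 0" by simp
  then have z: "z = 0" using *[of "unit_vec k 0"] k by (simp add: lin_poly_unit_vec)
  have left: "u $ j = 0" if "j < m" for j
    using basis_indpt[of "\<lambda>j. u $ j" j] y that by (simp add: y_def length_basis)
  \<comment> \<open>Since \<open>n - m \<le> m\<close>, the coefficients of \<open>z\<close> can be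
    padded with zeros to the whole basis, as \<open>basis_indpt\<close> demands.\<close>
  have "(\<Sum>j<m. \<iota> (if j < n - m then u $ (j + m) else 0) * \<Gamma> ! j) =
    (\<Sum>j<n - m. \<iota> (if j < n - m then u $ (j + m) else 0) * \<Gamma> ! j)"
    using n by (intro sum.mono_neutral_right) auto
  also have "\<dots> = z" unfolding z_def by (rule sum.cong) simp_all
  finally have right: "(if j < n - m then u $ (j + m) else 0) = 0" if "j < m" for j
    using basis_indpt[of "\<lambda>j. if j < n - m then u $ (j + m) else 0" j] z that by (simp add: length_basis)
  show ?thesis
  proof (rule eq_vecI)
    fix i assume i: "i < dim_vec (0\<^sub>v n :: 'a vec)"
    show "u $ i = 0\<^sub>v n $ i"
    proof (cases "i < m")
      case True
      then show ?thesis using left i by simp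
    next
      case False
      then have "i - m < m" "i - m < n - m" "i - m + m = i" using i n by auto
      then show ?thesis using right[of "i - m"] i by simp
    qed
  qed (use u in simp)
qed

lemma support_meet:
  assumes "c \<in> carrier_vec n" "c' \<in> carrier_vec n"
    and "n < rank_weight \<iota> \<Gamma> c + rank_weight \<iota> \<Gamma> c'"
  shows "rank_support \<iota> \<Gamma> c \<inter> rank_support \<iota> \<Gamma> c' \<noteq> {0\<^sub>v n}"
proof (rule subspaces_meet)
  have dim: "dim_vec c = n" "dim_vec c' = n" using assms by auto
  show "VectorSpace.subspace class_ring (rank_support \<iota> \<Gamma> c) (module_vec TYPE('a) n)"
    "VectorSpace.subspace class_ring (rank_support \<iota> \<Gamma> c') (module_vec TYPE('a) n)"
    using rank_support_subspace[of c] rank_support_subspace[of c'] by (simp_all add: dim)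
  show "n < subspace_dim n (rank_support \<iota> \<Gamma> c) + subspace_dim n (rank_support \<iota> \<Gamma> c')"
    using assms(3) by (simp add: rank_weight_def dim)
qed

lemma rank_weight_ext_gabidulin:
  assumes c: "c \<in> ext_gabidulin n k - {0\<^sub>v n}" and k: "0 < k" "k \<le> m" and n: "m \<le> n"
  shows "m - (k - 1) \<le> rank_weight \<iota> \<Gamma> c"
proof -
  obtain f where f: "f \<in> carrier_vec k" "c = codeword n f" using c by (auto simp: ext_gabidulin_def)
  have "f \<noteq> 0\<^sub>v k" using c f(2) codeword_zero[OF k(1), of n] by force
  then show ?thesis using rank_weight_codeword[OF f(1) _ k(2) n] f(2) by simp
qed

text \<open>Ensures that the minimum defining the distance is attained.\<close>

lemma ext_gabidulin_nonzero:
  assumes k: "0 < k" "k \<le> m" and n: "m \<le> n"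
  shows "ext_gabidulin n k - {0\<^sub>v n} \<noteq> {}"
proof -
  let ?e = "unit_vec k 0 :: 'b vec"
  have "?e $ 0 \<noteq> 0\<^sub>v k $ 0" using k by simp
  then have "?e \<noteq> 0\<^sub>v k" by metis
  then have "codeword n ?e \<noteq> 0\<^sub>v n" using k n by (intro codeword_nonzero[of _ k]) simp_all
  then show ?thesis unfolding ext_gabidulin_def using unit_vec_carrier by blast
qed

theorem ext_gabidulin_properties:
  assumes k: "2 \<le> k" "2 * k \<le> m + 1" and n: "m \<le> n" "n \<le> 2 * m - 2 * k + 1"
  defines "C \<equiv> ext_gabidulin n k"
  defines "d \<equiv> Min (rank_weight \<iota> \<Gamma> ` (C - {0\<^sub>v n}))"
  shows "rank_metric_code \<iota> \<Gamma> n k d C" "nondegenerate_code \<iota> \<Gamma> n C"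
    "rank_metric_intersecting \<iota> \<Gamma> n C" "n < 2 * d"
proof -
  \<comment> \<open>The upper bound on \<open>n\<close> says precisely that \<open>n\<close> is less
    than twice the guaranteed weight \<open>m - (k - 1)\<close>.\<close>
  have k': "0 < k" "k \<le> m" and n': "n \<le> 2 * m" "n < 2 * (m - (k - 1))" using k n by auto
  have weight: "n < 2 * rank_weight \<iota> \<Gamma> c" if "c \<in> C - {0\<^sub>v n}" for c
    using rank_weight_ext_gabidulin[of c n k] that k' n n' by (simp add: C_def)
  have C: "C \<subseteq> carrier_vec n" unfolding C_def ext_gabidulin_def using codeword_carrier by blast
  show "rank_metric_code \<iota> \<Gamma> n k d C"
    unfolding rank_metric_code_def C_def d_def
    using k' n ext_gabidulin_subspace subspace_dim_ext_gabidulin by simp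
  show "nondegenerate_code \<iota> \<Gamma> n C"
    using ext_gabidulin_kernel[OF k(1) n(1) n'(1)] C by (intro nondegenerate_codeI) (simp_all add: C_def)
  show "rank_metric_intersecting \<iota> \<Gamma> n C"
    unfolding rank_metric_intersecting_def
  proof (intro ballI support_meet)
    fix c c' assume c: "c \<in> C - {0\<^sub>v n}" "c' \<in> C - {0\<^sub>v n}"
    show "c \<in> carrier_vec n" "c' \<in> carrier_vec n" using c C by blast+
    show "n < rank_weight \<iota> \<Gamma> c + rank_weight \<iota> \<Gamma> c'" using weight[OF c(1)] weight[OF c(2)] by simp
  qed
  have "finite (C - {0\<^sub>v n})" using C finite_carrier_vec finite_subset by blast
  moreover have "C - {0\<^sub>v n} \<noteq> {}" unfolding C_def using k' n(1) by (rule ext_gabidulin_nonzero)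
  ultimately have "d \<in> rank_weight \<iota> \<Gamma> ` (C - {0\<^sub>v n})" unfolding d_def by (intro Min_in) simp_all
  then show "n < 2 * d" using weight by auto
qed

end

theorem theorem4p4:
  fixes \<iota> :: "'a :: {field, finite} \<Rightarrow> 'b :: {field, finite}"
    and \<Gamma> :: "'b list"
    and q m k :: nat
  assumes "primepow q"
    and "CARD('a) = q" and "CARD('b) = q ^ m"
    and "field_hom \<iota>"
    and "ext_basis \<iota> \<Gamma>"
    and "2 \<le> k" and "int k \<le> \<lfloor>(real m + 1) / 2\<rfloor>"
  shows "\<forall>n\<in>{m..2 * m - 2 * k + 1}. \<exists>C d.
           rank_metric_code \<iota> \<Gamma> n k d C \<and>
           nondegenerate_code \<iota> \<Gamma> n C \<and>
           rank_metric_intersecting \<iota> \<Gamma> n C \<and>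
           real d > real n / 2"
proof
  interpret finite_field_extension \<iota> \<Gamma> q m
    using assms by (simp add: finite_field_extension_def finite_field_extension_axioms_def)
  fix n assume "n \<in> {m..2 * m - 2 * k + 1}"
  then have n: "m \<le> n" "n \<le> 2 * m - 2 * k + 1" by simp_all
  \<comment> \<open>The floor may be dropped because \<open>k\<close> is an integer.\<close>
  have "real k \<le> (real m + 1) / 2" using assms(7) by (simp add: le_floor_iff)
  then have k: "2 * k \<le> m + 1" by simp
  note props = ext_gabidulin_properties[OF assms(6) k n]
  have "real n / 2 < real (Min (rank_weight \<iota> \<Gamma> ` (ext_gabidulin n k - {0\<^sub>v n})))"
    using props(4) by linarith
  then show "\<exists>C d. rank_metric_code \<iota> \<Gamma> n k d C \<and> nondegenerate_code \<iota> \<Gamma> n C \<and>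
      rank_metric_intersecting \<iota> \<Gamma> n C \<and> real d > real n / 2"
    using props(1-3) by blast
qed

end
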